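(* Let $\Pi_{prior}$ be a prior probability density on $\mathbb{R}^{N_\theta}$, let $\Pi_l(\theta)=\Pi_l(f_1^{data}\mid\theta)$ be the Gaussian likelihood, let $\mathcal{S}\subseteq\mathbb{R}^{N_\theta}$ be the feasible set, and let $\Pi^c_{post}(\theta)=c\,\chi_{\mathcal{S}}(\theta)\,\Pi_{prior}(\theta)\,\Pi_l(\theta)$ be the constrained posterior density, all as defined in the context. Let $K$ be the constrained random walk (cRW) transition kernel $$K(\theta,\theta^* )=\min\left\{1,\ \frac{\Pi_{prior}(\theta^* )\,\Pi_l(\theta^* )}{\Pi_{prior}(\theta)\,\Pi_l(\theta)}\cdot\chi_{\mathcal{S}}(\theta^* )\right\},\qquad \theta,\theta^*\in\mathbb{R}^{N_\theta}.$$ Then, given a feasible initial sample, $K$ satisfies the detailed balance condition with target $\Pi^c_{post}$: for every $\theta\in\mathcal{S}$ and every $\theta^*\in\mathbb{R}^{N_\theta}$, $$\Pi^c_{post}(\theta^* )\,K(\theta^*,\theta)=\Pi^c_{post}(\theta)\,K(\theta,\theta^* ).$$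
   Context: Setting. $\theta\in\mathbb{R}^{N_\theta}$ is a finite-dimensional parameter and $\boldsymbol{\xi}$ is an $\mathbb{R}^d$-valued random variable on a probability space, with Lebesgue probability density $\Pi_\xi$ and finite mean $\mathbb{E}_\xi=\int_{\mathbb{R}^d}\xi\,\Pi_\xi(\xi)\,d\xi$. The functions $f_1,f_2$ are real-valued functions of $(\xi,\theta)\in\mathbb{R}^d\times\mathbb{R}^{N_\theta}$ (with $\xi\mapsto f_2(\xi;\theta)$ measurable for each $\theta$): $f_1$ is the forward model and $f_2$ models the constraint. Real data $f^{data}_{1,1},\dots,f^{data}_{1,N}$ and a noise level $\sigma_l>0$ are fixed. Likelihood: $$\Pi_l(\theta)=\Pi_l(f_1^{data}\mid\theta):=\frac{1}{\sqrt{2\pi}\,\sigma_l}\exp\left(-\frac{1}{2N\sigma_l^2}\sum_{i=1}^N\left(f^{data}_{1,i}-f_1(\mathbb{E}_\xi,\theta)\right)^2\right).$$ Feasible set: for a fixed threshold $\beta\in\mathbb{R}$ and probability level $\alpha\in[0,1]$, $$\mathcal{S}:=\{\theta\in\mathbb{R}^{N_\theta}:\ \mathbb{P}_\xi(f_2(\boldsymbol{\xi};\theta)\le\beta)\ge\alpha\}.$$ A sample $\theta$ is called feasible if $\theta\in\mathcal{S}$. $\chi_{\mathcal{S}}$ denotes the indicator function of $\mathcal{S}$ (value $1$ on $\mathcal{S}$, $0$ elsewhere). Constrained posterior: $\Pi^c_{post}(\theta)=c\,\chi_{\mathcal{S}}(\theta)\,\Pi_{prior}(\theta)\,\Pi_l(\theta)$,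 where $c\in(0,\infty)$ is the normalization constant (it is assumed that $\chi_{\mathcal{S}}\Pi_{prior}\Pi_l$ has finite positive integral). Kernel: in $K(\theta,\theta^* )$, $\theta$ is the current sample and $\theta^*$ is the candidate proposed by a random walk with symmetric Gaussian proposal centered at the current sample; as in the source, $K$ denotes the acceptance probability itself. Where the denominator $\Pi_{prior}(\theta)\Pi_l(\theta)$ vanishes, $K(\theta,\theta^* )$ is set to $1$ by convention. *)

theory Defs
  imports "HOL-Probability.Probability"
begin

text \<open>
  Densities on the parameter space are taken with respect to \<^term>\<open>lebesgue\<close>, which covers both
  Borel and merely Lebesgue measurable densities.
\<close>

definition probability_density :: "('a::euclidean_space \<Rightarrow> real) \<Rightarrow> bool" where
  "probability_density p \<longleftrightarrow>
     p \<in> borel_measurable lebesgue \<and> (\<forall>x. 0 \<le> p x) \<and> (\<integral>\<^sup>+ x. ennreal (p x) \<partial>lebesgue) = 1"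

definition density_mean :: "('a::euclidean_space \<Rightarrow> real) \<Rightarrow> 'a" where
  "density_mean p = (\<integral>x. p x *\<^sub>R x \<partial>lborel)"

definition likelihood ::
  "(real^'d \<Rightarrow> real^'n \<Rightarrow> real) \<Rightarrow> real^'d \<Rightarrow> nat \<Rightarrow> (nat \<Rightarrow> real) \<Rightarrow> real \<Rightarrow> real^'n \<Rightarrow> real" where
  "likelihood f1 m N f1_data \<sigma> \<theta> =
     1 / (sqrt (2 * pi) * \<sigma>) *
     exp (- (1 / (2 * real N * \<sigma>\<^sup>2)) * (\<Sum>i = 1..N. (f1_data i - f1 m \<theta>)\<^sup>2))"

definition feasible_set ::
  "'w measure \<Rightarrow> ('w \<Rightarrow> real^'d) \<Rightarrow> (real^'d \<Rightarrow> real^'n \<Rightarrow> real) \<Rightarrow> real \<Rightarrow> real \<Rightarrow> (real^'n) set" where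
  "feasible_set M \<xi> f2 \<beta> \<alpha> = {\<theta>. \<P>(\<omega> in M. f2 (\<xi> \<omega>) \<theta> \<le> \<beta>) \<ge> \<alpha>}"

definition unnormalized_posterior ::
  "(real^'n) set \<Rightarrow> (real^'n \<Rightarrow> real) \<Rightarrow> (real^'n \<Rightarrow> real) \<Rightarrow> real^'n \<Rightarrow> real" where
  "unnormalized_posterior S prior l \<theta> = indicator S \<theta> * prior \<theta> * l \<theta>"

definition normalization_constant ::
  "(real^'n) set \<Rightarrow> (real^'n \<Rightarrow> real) \<Rightarrow> (real^'n \<Rightarrow> real) \<Rightarrow> real" where
  "normalization_constant S prior l = 1 / (\<integral>\<theta>. unnormalized_posterior S prior l \<theta> \<partial>lebesgue)"

definition constrained_posterior ::
  "(real^'n) set \<Rightarrow> (real^'n \<Rightarrow> real) \<Rightarrow> (real^'n \<Rightarrow> real) \<Rightarrow> real^'n \<Rightarrow> real" where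
  "constrained_posterior S prior l \<theta> =
     normalization_constant S prior l * unnormalized_posterior S prior l \<theta>"

text \<open>
  The kernel is the acceptance probability itself; the proposal density is symmetric and does not
  enter. The first argument after the likelihood is the current sample, the second the candidate.
  Since division by zero yields zero in HOL, the value 1 for a vanishing denominator has to be
  prescribed explicitly.
\<close>

definition crw_kernel ::
  "(real^'n) set \<Rightarrow> (real^'n \<Rightarrow> real) \<Rightarrow> (real^'n \<Rightarrow> real) \<Rightarrow> real^'n \<Rightarrow> real^'n \<Rightarrow> real" where
  "crw_kernel S prior l \<theta> \<theta>' =
     (if prior \<theta> * l \<theta> = 0 then 1
      else min 1 ((prior \<theta>' * l \<theta>') / (prior \<theta> * l \<theta>) * indicator S \<theta>'))"

end

theory Submission
  imports Defs
begin

text \<open>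
  With \<open>w = prior * l\<close>, multiplying the acceptance probability by its denominator turns the
  quotient into \<open>w \<theta> * K \<theta> \<theta>' = min (w \<theta>) (\<chi>\<^sub>S \<theta>' * w \<theta>')\<close>, which also covers \<open>w \<theta> = 0\<close>.
  For \<open>\<theta>' \<in> S\<close> this is symmetric; for \<open>\<theta>' \<notin> S\<close> both flows vanish.
\<close>

lemma likelihood_nonneg: "0 < \<sigma> \<Longrightarrow> 0 \<le> likelihood f1 m N f1_data \<sigma> \<theta>"
  by (simp add: likelihood_def)

lemma mult_crw_kernel:
  assumes "0 \<le> prior \<theta> * l \<theta>" and "0 \<le> prior \<theta>' * l \<theta>'"
  shows "prior \<theta> * l \<theta> * crw_kernel S prior l \<theta> \<theta>' =
    min (prior \<theta> * l \<theta>) (indicator S \<theta>' * (prior \<theta>' * l \<theta>'))"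
proof (cases "prior \<theta> * l \<theta> = 0")
  case True
  \<comment> \<open>Both sides are 0: the left one through its factor
    \<open>prior \<theta> * l \<theta>\<close>, whatever value the kernel takes, and the right one
    because the other argument of \<open>min\<close> is nonnegative.\<close>
  then show ?thesis
    using assms(2) by (simp only: True) (simp add: indicator_def)
next
  case False
  define x where "x = prior \<theta> * l \<theta>"
  define y where "y = prior \<theta>' * l \<theta>' * indicator S \<theta>'"
  have "0 < x"
    using False assms(1) unfolding x_def by linarith
  \<comment> \<open>Multiplication by a positive number commutes with \<open>min\<close> and cancels
    the denominator.\<close>
  then have "x * min 1 (y / x) = min x y"
    by (simp add: min_def field_simps)
  moreover have "crw_kernel S prior l \<theta> \<theta>' = min 1 (y / x)"
    using False by (simp add: crw_kernel_def x_def y_def)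
  ultimately show ?thesis
    by (simp add: x_def y_def mult.commute)
qed

text \<open>A pointwise identity: the normalization constant is a common factor of both flows, so
  only the minima of the weights \<open>prior * l\<close> have to be compared.\<close>

lemma crw_kernel_detailed_balance:
  assumes nonneg: "\<And>\<theta>. 0 \<le> prior \<theta> * l \<theta>" and "\<theta> \<in> S"
  shows "constrained_posterior S prior l \<theta>' * crw_kernel S prior l \<theta>' \<theta> =
    constrained_posterior S prior l \<theta> * crw_kernel S prior l \<theta> \<theta>'"
proof -
  have flow: "constrained_posterior S prior l x * crw_kernel S prior l x y =
      normalization_constant S prior l *
        (indicator S x * min (prior x * l x) (indicator S y * (prior y * l y)))" for x y
    \<comment> \<open>The identity is applied from right to left: \<open>mult.assoc\<close> nests
      products to the right, so its left-hand side would no longer match.\<close>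
    by (simp add: mult_crw_kernel[where prior = prior and l = l, OF nonneg nonneg, symmetric]
        constrained_posterior_def unnormalized_posterior_def mult.assoc)
  \<comment> \<open>Unfolding the indicators splits on \<open>\<theta>' \<in> S\<close>. Inside
    \<open>S\<close> the two minima differ by the order of their arguments; outside, the left flow
    has indicator 0 and the right one is \<open>min (prior \<theta> * l \<theta>) 0\<close>, which
    is 0 by nonnegativity.\<close>
  show ?thesis
    using assms by (simp add: flow indicator_def min.commute)
qed

theorem theorem1:
  fixes M :: "'w measure"
    and \<xi> :: "'w \<Rightarrow> real^'d"
    and p_\<xi> :: "real^'d \<Rightarrow> real"
    and f1 f2 :: "real^'d \<Rightarrow> real^'n \<Rightarrow> real"
    and N :: nat and f1_data :: "nat \<Rightarrow> real"
    and \<sigma> \<alpha> \<beta> :: real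
    and prior l :: "real^'n \<Rightarrow> real"
    and S :: "(real^'n) set"
  assumes "prob_space M"
    and "\<And>x. 0 \<le> p_\<xi> x"
    and "distributed M lborel \<xi> (\<lambda>x. ennreal (p_\<xi> x))"
    and "integrable lborel (\<lambda>x. p_\<xi> x *\<^sub>R x)"
    and "\<And>\<theta>. (\<lambda>x. f2 x \<theta>) \<in> borel_measurable borel"
    and "1 \<le> N" and "0 < \<sigma>" and "0 \<le> \<alpha>" and "\<alpha> \<le> 1"
    and "probability_density prior"
    and l_def: "l = likelihood f1 (density_mean p_\<xi>) N f1_data \<sigma>"
    and S_def: "S = feasible_set M \<xi> f2 \<beta> \<alpha>"
    and "integrable lebesgue (unnormalized_posterior S prior l)"
    and "0 < (\<integral>\<theta>. unnormalized_posterior S prior l \<theta> \<partial>lebesgue)"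
  shows "\<forall>\<theta>\<in>S. \<forall>\<theta>'.
    constrained_posterior S prior l \<theta>' * crw_kernel S prior l \<theta>' \<theta> =
    constrained_posterior S prior l \<theta> * crw_kernel S prior l \<theta> \<theta>'"
proof -
  \<comment> \<open>A density is nonnegative, and \<open>0 < \<sigma>\<close> fixes the sign of the
    prefactor of the likelihood.\<close>
  have "0 \<le> prior \<theta> * l \<theta>" for \<theta>
    using \<open>probability_density prior\<close> \<open>0 < \<sigma>\<close>
    by (simp add: probability_density_def l_def likelihood_nonneg)
  then show ?thesis
    by (blast intro: crw_kernel_detailed_balance)
qed

end
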